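(* Let $G$ be any group and let $S$ be any subset of $G$. Then the fusion set $F_S$ of $S$ with respect to $(A_G,\prec)$ is \[ F_S=\{\chi_{\langle R\rangle} \mid R\subseteq S\}, \] i.e. it consists of the characteristic functions of the subgroups generated by all subsets of $S$, with the convention $\langle\emptyset\rangle=\{e\}$.
   Context: For a group $G$ and a subgroup $H$, let $\chi_H\colon G\to\{0,1\}$ be the characteristic function of $H$. Let $(A_G,\prec)$ be the set of characteristic functions of all subgroups of $G$, partially ordered by $\chi_H\prec\chi_K$ iff $H\subseteq K$. For $S\subseteq G$ and $f\in A_G$, $f$ is Occam on $S$ if $f$ is the least element (with respect to $\prec$) of $\{g\in A_G \mid g|_S=f|_S\}$. The fusion set $F_S$ of $S$ is the set of all $f\in A_G$ that are Occam on $S$. *)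

theory Defs
  imports "HOL-Algebra.Algebra"
begin

text \<open>A map \<open>G \<rightarrow> {0,1}\<close> is an extensional function on \<open>carrier G\<close>, so that
  HOL equality of such maps is their equality on \<open>carrier G\<close>.\<close>

definition char_fun :: "('a, 'b) monoid_scheme \<Rightarrow> 'a set \<Rightarrow> 'a \<Rightarrow> nat" where
  "char_fun G H = (\<lambda>x\<in>carrier G. if x \<in> H then 1 else 0)"

definition subgroup_order :: "('a, 'b) monoid_scheme \<Rightarrow> ('a \<Rightarrow> nat) gorder" where
  "subgroup_order G =
     \<lparr>carrier = {char_fun G H |H. subgroup H G},
      eq = (=),
      le = (\<lambda>f g. \<exists>H K. subgroup H G \<and> subgroup K G \<and>
                       f = char_fun G H \<and> g = char_fun G K \<and> H \<subseteq> K)\<rparr>"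

definition occam_on :: "('a \<Rightarrow> 'c) gorder \<Rightarrow> 'a set \<Rightarrow> ('a \<Rightarrow> 'c) \<Rightarrow> bool" where
  "occam_on A S f \<longleftrightarrow> least A f {g \<in> carrier A. restrict g S = restrict f S}"

definition fusion_set :: "('a \<Rightarrow> 'c) gorder \<Rightarrow> 'a set \<Rightarrow> ('a \<Rightarrow> 'c) set" where
  "fusion_set A S = {f \<in> carrier A. occam_on A S f}"

lemma char_fun_mem: "char_fun G H \<in> carrier G \<rightarrow>\<^sub>E {0, 1}"
  by (auto simp: char_fun_def)

lemma char_fun_inject:
  assumes "H \<subseteq> carrier G" "K \<subseteq> carrier G" "char_fun G H = char_fun G K"
  shows "H = K"
proof -
  have "x \<in> H \<longleftrightarrow> x \<in> K" if "x \<in> carrier G" for x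
    using fun_cong[OF assms(3), of x] that by (simp add: char_fun_def split: if_splits)
  with assms(1,2) show ?thesis by blast
qed

lemma subgroup_order_le_iff:
  assumes "subgroup H G" "subgroup K G"
  shows "char_fun G H \<sqsubseteq>\<^bsub>subgroup_order G\<^esub> char_fun G K \<longleftrightarrow> H \<subseteq> K"
proof -
  have "H = L" if "subgroup H G" "subgroup L G" "char_fun G H = char_fun G L" for H L
    by (rule char_fun_inject[OF that(1,2)[THEN subgroup.subset] that(3)])
  with assms show ?thesis
    unfolding subgroup_order_def by simp blast
qed

lemma partial_order_subgroup_order: "partial_order (subgroup_order G)"
proof
  fix f g h
  assume fgh: "f \<in> carrier (subgroup_order G)" "g \<in> carrier (subgroup_order G)"
    "h \<in> carrier (subgroup_order G)"
  then obtain H K L where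
    "subgroup H G" "f = char_fun G H" "subgroup K G" "g = char_fun G K"
    "subgroup L G" "h = char_fun G L"
    by (auto simp: subgroup_order_def)
  then show "f \<sqsubseteq>\<^bsub>subgroup_order G\<^esub> g \<Longrightarrow> g \<sqsubseteq>\<^bsub>subgroup_order G\<^esub> h \<Longrightarrow> f \<sqsubseteq>\<^bsub>subgroup_order G\<^esub> h"
    by (simp add: subgroup_order_le_iff)
next
  fix f g
  assume fg: "f \<in> carrier (subgroup_order G)" "g \<in> carrier (subgroup_order G)"
  then obtain H K where
    HK: "subgroup H G" "f = char_fun G H" "subgroup K G" "g = char_fun G K"
    by (auto simp: subgroup_order_def)
  assume "f \<sqsubseteq>\<^bsub>subgroup_order G\<^esub> g" "g \<sqsubseteq>\<^bsub>subgroup_order G\<^esub> f"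
  with HK have "f = g" by (auto simp: subgroup_order_le_iff)
  then show "f .=\<^bsub>subgroup_order G\<^esub> g" by (simp add: subgroup_order_def)
qed (auto simp: subgroup_order_def)

end

theory Submission imports Defs begin

text \<open>Two characteristic functions agree on S exactly when their subgroups have the same trace
  on S (\<open>restrict_char_fun_eq_iff\<close>). Hence the function of H is Occam iff H lies in
  every subgroup K with K \<inter> S = H \<inter> S (\<open>occam_on_char_fun_iff\<close>). The
  subgroup generated by H \<inter> S is such a K and lies in H, so an Occam H equals it. Conversely,
  any subgroup with the same trace as the one generated by some R \<subseteq> S contains R, hence
  all that R generates.\<close>

text \<open>Inside the carrier the values 0 and 1 decide membership; outside it every
  \<open>char_fun\<close> is \<open>undefined\<close>, so S must stay inside for the trace to be
  recovered.\<close>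

lemma restrict_char_fun_eq_iff:
  assumes "S \<subseteq> carrier G"
  shows "restrict (char_fun G H) S = restrict (char_fun G K) S \<longleftrightarrow> H \<inter> S = K \<inter> S"
proof
  assume eq: "restrict (char_fun G H) S = restrict (char_fun G K) S"
  have "x \<in> H \<longleftrightarrow> x \<in> K" if "x \<in> S" for x
    using fun_cong[OF eq, of x] that assms
    by (auto simp: char_fun_def split: if_splits)
  then show "H \<inter> S = K \<inter> S" by blast
next
  assume "H \<inter> S = K \<inter> S"
  then show "restrict (char_fun G H) S = restrict (char_fun G K) S"
    by (intro ext) (auto simp: char_fun_def restrict_def)
qed

text \<open>The function of H always belongs to its own agreement class, so only the lower-bound
  half of \<open>least\<close> remains, and the order on functions becomes inclusion of
  subgroups.\<close>

lemma occam_on_char_fun_iff: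
  assumes "S \<subseteq> carrier G" "subgroup H G"
  shows "occam_on (subgroup_order G) S (char_fun G H) \<longleftrightarrow>
    (\<forall>K. subgroup K G \<and> K \<inter> S = H \<inter> S \<longrightarrow> H \<subseteq> K)"
proof -
  have carrier: "carrier (subgroup_order G) = {char_fun G K |K. subgroup K G}"
    by (simp add: subgroup_order_def)
  have "occam_on (subgroup_order G) S (char_fun G H) \<longleftrightarrow>
    (\<forall>K. subgroup K G \<and> restrict (char_fun G K) S = restrict (char_fun G H) S \<longrightarrow>
      char_fun G H \<sqsubseteq>\<^bsub>subgroup_order G\<^esub> char_fun G K)"
    using assms(2) unfolding occam_on_def least_def carrier by blast
  then show ?thesis
    using assms by (auto simp: restrict_char_fun_eq_iff subgroup_order_le_iff)
qed

theorem theorem3p1: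
  fixes G :: "('a, 'b) monoid_scheme" and S :: "'a set"
  assumes "group G"
    and "S \<subseteq> carrier G"
  shows "fusion_set (subgroup_order G) S = {char_fun G (generate G R) |R. R \<subseteq> S}"
proof (intro equalityI subsetI)
  interpret group G by fact
  fix f assume "f \<in> fusion_set (subgroup_order G) S"
  then obtain H where H: "subgroup H G" "f = char_fun G H"
    and occam: "occam_on (subgroup_order G) S (char_fun G H)"
    by (auto simp: fusion_set_def subgroup_order_def)
  \<comment> \<open>The smallest subgroup that can have the trace of H. Its generating set H
    \<inter> S is also the R that the conclusion asks for.\<close>
  let ?K = "generate G (H \<inter> S)"
  have sub: "?K \<subseteq> H" using H(1) by (intro generate_subgroup_incl) auto
  have "H \<inter> S \<subseteq> ?K" by (auto intro: generate.incl)
  with sub have "?K \<inter> S = H \<inter> S" by blast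
  moreover have "subgroup ?K G" using assms(2) by (intro generate_is_subgroup) auto
  ultimately have "H \<subseteq> ?K"
    using occam assms(2) H(1) by (auto simp: occam_on_char_fun_iff)
  with sub H(2) have "f = char_fun G ?K" by simp
  then show "f \<in> {char_fun G (generate G R) |R. R \<subseteq> S}" by blast
next
  interpret group G by fact
  fix f assume "f \<in> {char_fun G (generate G R) |R. R \<subseteq> S}"
  then obtain R where R: "R \<subseteq> S" "f = char_fun G (generate G R)" by blast
  have sub: "subgroup (generate G R) G"
    using R(1) assms(2) by (intro generate_is_subgroup) auto
  have "generate G R \<subseteq> K" if "subgroup K G" "K \<inter> S = generate G R \<inter> S" for K
  proof (rule generate_subgroup_incl)
    \<comment> \<open>R lies both in S and in the subgroup it generates, hence in the common
      trace.\<close>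
    show "R \<subseteq> K" using that(2) R(1) generate.incl[of _ R G] by blast
  qed fact
  then have "occam_on (subgroup_order G) S f"
    using sub assms(2) R(2) by (auto simp: occam_on_char_fun_iff)
  with sub R(2) show "f \<in> fusion_set (subgroup_order G) S"
    by (auto simp: fusion_set_def subgroup_order_def)
qed

end
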